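(* Let $F$ be a polynomial with complex coefficients of degree $n\ge 1$. Then there is a sequence of radii $r_1,\dots,r_n>0$ such that the iterated $r$-Blaschke factorization of $F$ with these radii, namely the sequence of polynomials $P_0,P_1,\dots,P_n$ given by $P_0=F$ and $$P_{i-1}(z)-P_{i-1}(0)=B_{r_i}(z)\cdot P_i(z)\qquad(1\le i\le n),$$ satisfies the contraction inequality $$\left\|\frac{1}{r_i^{\,d_i}}\,P_i\right\|_{\mathcal D}^2\ \le\ \frac12\,\bigl\|P_{i-1}-P_{i-1}(0)\bigr\|_{\mathcal D}^2$$ at every iteration $i\in\{1,\dots,n\}$ for which $P_{i-1}$ is nonconstant, where $d_i=\deg\bigl(P_{i-1}-P_{i-1}(0)\bigr)$.
   Context: $r$-Blaschke factorization: for $r>0$ and a nonzero polynomial $P$, let $$B_r(z)=\prod_i\frac{(z-\beta_i)\,r}{r^2-\overline{\beta_i}z},$$ the product being over the roots $\beta_i$ of $P$, counted with multiplicity, with $|\beta_i|<r$. The $r$-Blaschke factorization of $P$ is $P=B_r\cdot G$; here $G=P/B_r$ is the polynomial obtained from $P$ by replacing each factor $z-\beta_i$ with $|\beta_i|<r$ by $\frac1r(r^2-\overline{\beta_i}z)$. In the iteration, $B_{r_i}$ is the product associated with the polynomial $P_{i-1}-P_{i-1}(0)$ and the radius $r_i$. If $P_{i-1}$ is constant, the iteration has terminated; by convention all subsequent $P_j$ are $0$. Dirichlet (semi)norm: for $f(z)=\sum_{k\ge 0}a_kz^k$, $\|f\|_{\mathcal D}^2=\sum_{k\ge 1}k|a_k|^2$.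 *)

theory Defs
  imports "HOL-Analysis.Analysis" "HOL-Computational_Algebra.Computational_Algebra"
begin

definition blaschke_factor :: "real \<Rightarrow> complex \<Rightarrow> complex \<Rightarrow> complex" where
  "blaschke_factor r \<beta> z = ((z - \<beta>) * of_real r) / ((of_real r)\<^sup>2 - cnj \<beta> * z)"

definition inner_roots :: "real \<Rightarrow> complex poly \<Rightarrow> complex multiset" where
  "inner_roots r P = filter_mset (\<lambda>\<beta>. cmod \<beta> < r) (proots P)"

definition blaschke_product :: "real \<Rightarrow> complex poly \<Rightarrow> complex \<Rightarrow> complex" where
  "blaschke_product r P z = (\<Prod>\<beta>\<in>#inner_roots r P. blaschke_factor r \<beta> z)"

text \<open>
  The identity \<open>P = B\<^sub>r \<cdot> G\<close> is one of rational functions. Since division by zero yields zero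
  in HOL, it is stated at the points that are not zeros of a denominator of \<open>B\<^sub>r\<close>. Those zeros
  are finitely many and lie outside the closed disc of radius \<open>r\<close>, so for \<open>r > 0\<close> and
  \<open>P \<noteq> 0\<close> the polynomial \<open>G\<close> is determined by \<open>P\<close> and \<open>r\<close>;
  see \<open>blaschke_factorization_iff\<close> below.
\<close>

definition blaschke_factorization :: "real \<Rightarrow> complex poly \<Rightarrow> complex poly \<Rightarrow> bool" where
  "blaschke_factorization r P G \<longleftrightarrow>
     (\<forall>z. (\<forall>\<beta>\<in>#inner_roots r P. (of_real r)\<^sup>2 - cnj \<beta> * z \<noteq> 0) \<longrightarrow>
        poly P z = blaschke_product r P z * poly G z)"

definition minus_const :: "complex poly \<Rightarrow> complex poly" where
  "minus_const P = P - [:poly P 0:]"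

definition iterated_blaschke ::
    "complex poly \<Rightarrow> nat \<Rightarrow> (nat \<Rightarrow> real) \<Rightarrow> (nat \<Rightarrow> complex poly) \<Rightarrow> bool" where
  "iterated_blaschke F n r P \<longleftrightarrow>
     P 0 = F \<and>
     (\<forall>i\<in>{1..n}.
        if degree (P (i - 1)) = 0 then P i = 0
        else blaschke_factorization (r i) (minus_const (P (i - 1))) (P i))"

definition dirichlet_norm_sq :: "complex poly \<Rightarrow> real" where
  "dirichlet_norm_sq P = (\<Sum>k=1..degree P. real k * (cmod (coeff P k))\<^sup>2)"

text \<open>
  The factorization exists and is unique: \<open>G\<close> arises from \<open>P\<close> by replacing each factor
  \<open>z - \<beta>\<close> with \<open>\<bar>\<beta>\<bar> < r\<close> by \<open>(r\<^sup>2 - cnj \<beta> * z) / r\<close>.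
\<close>

definition blaschke_cofactor :: "real \<Rightarrow> complex poly \<Rightarrow> complex poly" where
  "blaschke_cofactor r P =
     smult (lead_coeff P)
       (\<Prod>\<beta>\<in>#proots P. if cmod \<beta> < r
          then smult (1 / of_real r) [:(of_real r)\<^sup>2, - cnj \<beta>:] else [:- \<beta>, 1:])"

lemma blaschke_denom_nonzero:
  assumes "r > 0" "cmod \<beta> < r" "cmod z < r"
  shows "(of_real r)\<^sup>2 - cnj \<beta> * z \<noteq> 0"
proof
  assume "(of_real r)\<^sup>2 - cnj \<beta> * z = 0"
  hence "cmod ((of_real r)\<^sup>2) = cmod (cnj \<beta> * z)" by simp
  hence "r * r = cmod \<beta> * cmod z"
    using assms by (simp add: norm_mult norm_power power2_eq_square)
  moreover have "cmod \<beta> * cmod z < r * r"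
    using assms by (intro mult_strict_mono) auto
  ultimately show False by simp
qed

lemma blaschke_factorization_cofactor:
  assumes "r > 0"
  shows "blaschke_factorization r P (blaschke_cofactor r P)"
  unfolding blaschke_factorization_def
proof (intro allI impI)
  fix z assume nz: "\<forall>\<beta>\<in>#inner_roots r P. (of_real r)\<^sup>2 - cnj \<beta> * z \<noteq> 0"
  have key: "poly (\<Prod>\<beta>\<in>#A. [:- \<beta>, 1:]) z =
      (\<Prod>\<beta>\<in>#filter_mset (\<lambda>\<beta>. cmod \<beta> < r) A. blaschke_factor r \<beta> z) *
      poly (\<Prod>\<beta>\<in>#A. if cmod \<beta> < r
          then smult (1 / of_real r) [:(of_real r)\<^sup>2, - cnj \<beta>:] else [:- \<beta>, 1:]) z"
    if "\<forall>\<beta>\<in>#filter_mset (\<lambda>\<beta>. cmod \<beta> < r) A. (of_real r)\<^sup>2 - cnj \<beta> * z \<noteq> 0" for A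
    using that
  proof (induction A)
    case (add x A)
    let ?Q = "\<Prod>\<beta>\<in>#A. if cmod \<beta> < r
          then smult (1 / of_real r) [:(of_real r)\<^sup>2, - cnj \<beta>:] else [:- \<beta>, 1:]"
    let ?B = "\<Prod>\<beta>\<in>#filter_mset (\<lambda>\<beta>. cmod \<beta> < r) A. blaschke_factor r \<beta> z"
    have IH: "poly (\<Prod>\<beta>\<in>#A. [:- \<beta>, 1:]) z = ?B * poly ?Q z"
      using add by auto
    show ?case
    proof (cases "cmod x < r")
      case True
      have "z - x = blaschke_factor r x z * poly (smult (1 / of_real r) [:(of_real r)\<^sup>2, - cnj x:]) z"
        using add.prems True assms by (simp add: blaschke_factor_def field_simps)
      moreover have "poly [:- x, 1:] z = z - x" by simp
      ultimately show ?thesis using True IH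
        by (simp only: image_mset_add_mset prod_mset.add_mset poly_mult if_True
            filter_mset_add_mset mult_ac)
    next
      case False
      thus ?thesis using IH by (simp add: algebra_simps)
    qed
  qed auto
  have "poly P z = poly (smult (lead_coeff P) (\<Prod>\<beta>\<in>#proots P. [:- \<beta>, 1:])) z"
    by (simp only: complex_poly_decompose_multiset)
  thus "poly P z = blaschke_product r P z * poly (blaschke_cofactor r P) z"
    using key[of "proots P"] nz
    by (simp add: inner_roots_def blaschke_product_def blaschke_cofactor_def)
qed

lemma blaschke_factorization_iff:
  assumes "r > 0" "P \<noteq> 0"
  shows "blaschke_factorization r P G \<longleftrightarrow> G = blaschke_cofactor r P"
proof
  let ?H = "blaschke_cofactor r P"
  assume G: "blaschke_factorization r P G"
  note H = blaschke_factorization_cofactor[OF assms(1), of P]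
  have "poly (G - ?H) z = 0" if z: "z \<in> ball 0 r - {z. poly P z = 0}" for z
  proof -
    have nz: "\<forall>\<beta>\<in>#inner_roots r P. (of_real r)\<^sup>2 - cnj \<beta> * z \<noteq> 0"
      using z assms blaschke_denom_nonzero by (auto simp: inner_roots_def)
    have 1: "poly P z = blaschke_product r P z * poly G z"
      using G nz unfolding blaschke_factorization_def by blast
    have 2: "poly P z = blaschke_product r P z * poly ?H z"
      using H nz unfolding blaschke_factorization_def by blast
    have "poly P z \<noteq> 0" using z by simp
    with 1 2 show ?thesis by auto
  qed
  hence "ball 0 r - {z. poly P z = 0} \<subseteq> {z. poly (G - ?H) z = 0}" by blast
  moreover have "infinite (ball (0::complex) r - {z. poly P z = 0})"
    using assms poly_roots_finite uncountable_ball[of r "0::complex"] countable_finite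
    by (intro Diff_infinite_finite) auto
  ultimately have "infinite {z. poly (G - ?H) z = 0}"
    using finite_subset by blast
  hence "G - ?H = 0" using poly_roots_finite by blast
  thus "G = ?H" by simp
qed (use assms blaschke_factorization_cofactor in simp)

end

theory Submission
  imports Defs "HOL-Real_Asymp.Real_Asymp"
begin

text \<open>
  A single large radius suffices at each step. If \<open>Q\<close> has degree \<open>d\<close> and \<open>r\<close> exceeds the
  modulus of every root of \<open>Q\<close>, then all \<open>d\<close> linear factors of \<open>Q\<close> are replaced, and dividing
  each replacement by \<open>r\<close> turns it into \<open>1 - cnj \<beta> * z / r\<^sup>2\<close>. Hence \<open>G / r\<^sup>d\<close> is the dilation
  \<open>z \<mapsto> C (z / r\<^sup>2)\<close> of the polynomial \<open>C = c \<cdot> \<Prod>(1 - cnj \<beta> * z)\<close>, where \<open>c\<close> is the leading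
  coefficient of \<open>Q\<close> (\<open>scaled_cofactor_eq_dilation\<close>), and \<open>C\<close> does not depend on \<open>r\<close>. The
  Dirichlet norm ignores the constant term, so for \<open>r \<ge> 1\<close> the dilation multiplies its square by at most
  \<open>r\<^sup>-\<^sup>4\<close> (\<open>dirichlet_norm_sq_dilation_le\<close>). Thus the squared norm of \<open>G / r\<^sup>d\<close> tends to \<open>0\<close> as
  \<open>r \<rightarrow> \<infinity>\<close>, whereas \<open>Q\<close> is nonconstant and has positive squared norm, so it drops below half
  of the latter for some \<open>r\<close>.
\<close>

lemma dirichlet_norm_sq_nonneg: "dirichlet_norm_sq p \<ge> 0"
  unfolding dirichlet_norm_sq_def by (intro sum_nonneg) auto

lemma dirichlet_norm_sq_pos:
  assumes "degree p > 0"
  shows "dirichlet_norm_sq p > 0"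
  unfolding dirichlet_norm_sq_def
proof (rule sum_pos2)
  show "degree p \<in> {1..degree p}" using assms by simp
  show "0 < real (degree p) * (cmod (coeff p (degree p)))\<^sup>2"
  proof -
    have "p \<noteq> 0" using assms by auto
    thus ?thesis using assms by simp
  qed
qed auto

lemma degree_minus_const: "degree (minus_const P) = degree P"
proof (cases "degree P = 0")
  case True
  then obtain c where "P = [:c:]" by (rule degree_eq_zeroE)
  thus ?thesis by (simp add: minus_const_def)
next
  case False
  hence "degree (P + (- [:poly P 0:])) = degree P"
    by (intro degree_add_eq_left) simp
  thus ?thesis by (simp only: minus_const_def add_uminus_conv_diff)
qed

lemma dirichlet_norm_sq_dilation_le:
  fixes a :: complex
  assumes "a \<noteq> 0" "cmod a \<le> 1"
  shows "dirichlet_norm_sq (p \<circ>\<^sub>p [:0, a:]) \<le> (cmod a)\<^sup>2 * dirichlet_norm_sq p"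
proof -
  have deg: "degree (p \<circ>\<^sub>p [:0, a:]) = degree p"
    using assms by (simp add: degree_pcompose)
  have "real k * (cmod (a ^ k * coeff p k))\<^sup>2 \<le> (cmod a)\<^sup>2 * (real k * (cmod (coeff p k))\<^sup>2)"
    if "k \<ge> 1" for k
  proof -
    have "cmod a ^ k \<le> cmod a ^ 1"
      using assms that by (intro power_decreasing) auto
    hence "(cmod a ^ k)\<^sup>2 \<le> (cmod a)\<^sup>2"
      by (intro power_mono) auto
    hence "(cmod a ^ k)\<^sup>2 * (real k * (cmod (coeff p k))\<^sup>2)
        \<le> (cmod a)\<^sup>2 * (real k * (cmod (coeff p k))\<^sup>2)"
      by (intro mult_right_mono) auto
    thus ?thesis
      by (simp add: norm_mult norm_power power_mult_distrib mult_ac)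
  qed
  thus ?thesis
    unfolding dirichlet_norm_sq_def deg
    by (auto simp: coeff_pcompose_linear sum_distrib_left intro!: sum_mono)
qed

text \<open>
  This is the conjugate-reciprocal polynomial \<open>z\<^sup>d \<cdot> cnj (Q (1 / cnj z))\<close> of \<open>Q\<close>, up to a
  constant factor of modulus one.
\<close>

definition reciprocal_poly :: "complex poly \<Rightarrow> complex poly" where
  "reciprocal_poly Q = smult (lead_coeff Q) (\<Prod>\<beta>\<in>#proots Q. [:1, - cnj \<beta>:])"

text \<open>
  Once every root is reflected, the number of factors is the degree, because the roots are
  counted with multiplicity over \<open>\<complex>\<close>; so each factor receives exactly one of the \<open>d\<close> divisions
  by \<open>r\<close>.
\<close>

lemma scaled_cofactor_eq_dilation:
  assumes "r > 0" and roots: "\<And>\<beta>. \<beta> \<in># proots Q \<Longrightarrow> cmod \<beta> < r"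
  shows "smult (1 / of_real r ^ degree Q) (blaschke_cofactor r Q)
       = reciprocal_poly Q \<circ>\<^sub>p [:0, 1 / (of_real r)\<^sup>2:]"
proof -
  have factors:
    "smult (1 / of_real r ^ size A)
        (\<Prod>\<beta>\<in>#A. if cmod \<beta> < r
           then smult (1 / of_real r) [:(of_real r)\<^sup>2, - cnj \<beta>:] else [:- \<beta>, 1:])
      = (\<Prod>\<beta>\<in>#A. [:1, - cnj \<beta>:]) \<circ>\<^sub>p [:0, 1 / (of_real r)\<^sup>2:]"
    if "\<And>\<beta>. \<beta> \<in># A \<Longrightarrow> cmod \<beta> < r" for A
    using that
  proof (induction A)
    case empty
    show ?case by (simp add: pcompose_1)
  next
    case (add x A)
    let ?f = "\<lambda>\<beta>. if cmod \<beta> < r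
           then smult (1 / of_real r) [:(of_real r)\<^sup>2, - cnj \<beta>:] else [:- \<beta>, 1:]"
    have IH: "smult (1 / of_real r ^ size A) (\<Prod>\<beta>\<in>#A. ?f \<beta>)
        = (\<Prod>\<beta>\<in>#A. [:1, - cnj \<beta>:]) \<circ>\<^sub>p [:0, 1 / (of_real r)\<^sup>2:]"
      using add by simp
    have x: "smult (1 / of_real r) (?f x) = [:1, - cnj x:] \<circ>\<^sub>p [:0, 1 / (of_real r)\<^sup>2:]"
      using add.prems[of x] assms(1)
      by (simp add: pcompose_pCons power2_eq_square)
    have "smult (1 / of_real r ^ size (add_mset x A)) (\<Prod>\<beta>\<in>#add_mset x A. ?f \<beta>)
        = smult (1 / of_real r) (?f x) * smult (1 / of_real r ^ size A) (\<Prod>\<beta>\<in>#A. ?f \<beta>)"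
      by (simp only: image_mset_add_mset prod_mset.add_mset mult_smult_left mult_smult_right
          smult_smult size_add_mset power_Suc times_divide_times_eq mult_1_left mult_ac)
    also have "\<dots> = (\<Prod>\<beta>\<in>#add_mset x A. [:1, - cnj \<beta>:]) \<circ>\<^sub>p [:0, 1 / (of_real r)\<^sup>2:]"
      unfolding x IH by (simp only: pcompose_mult image_mset_add_mset prod_mset.add_mset)
    finally show ?case .
  qed
  have "size (proots Q) = degree Q"
    by (rule size_proots_complex)
  with factors[of "proots Q"] roots show ?thesis
    unfolding blaschke_cofactor_def reciprocal_poly_def pcompose_smult
    by (metis (no_types, lifting) mult.commute smult_smult)
qed

lemma dirichlet_norm_sq_scaled_cofactor_tendsto_0:
  "((\<lambda>r. dirichlet_norm_sq (smult (1 / of_real r ^ degree Q) (blaschke_cofactor r Q)))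
      \<longlongrightarrow> 0) at_top"
proof -
  let ?D = "dirichlet_norm_sq (reciprocal_poly Q)"
  have lim: "((\<lambda>r::real. (1 / r ^ 4) * ?D) \<longlongrightarrow> 0) at_top"
    by real_asymp
  have "\<forall>\<^sub>F r in at_top. \<forall>\<beta>\<in>set_mset (proots Q). cmod \<beta> < r"
    by (intro eventually_ball_finite ballI eventually_gt_at_top) simp
  moreover have "\<forall>\<^sub>F r in at_top. r \<ge> (1::real)"
    by (rule eventually_ge_at_top)
  ultimately have bound: "\<forall>\<^sub>F r in at_top.
      dirichlet_norm_sq (smult (1 / of_real r ^ degree Q) (blaschke_cofactor r Q))
        \<le> (1 / r ^ 4) * ?D"
  proof eventually_elim
    case (elim r)
    let ?a = "1 / (of_real r)\<^sup>2 :: complex"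
    have a: "cmod ?a = 1 / r\<^sup>2"
      using elim by (simp add: norm_divide norm_power)
    have "1 / r\<^sup>2 \<le> 1"
      using elim one_le_power[of r 2] by simp
    hence "dirichlet_norm_sq (reciprocal_poly Q \<circ>\<^sub>p [:0, ?a:]) \<le> (cmod ?a)\<^sup>2 * ?D"
      using elim a by (intro dirichlet_norm_sq_dilation_le) auto
    also have "(cmod ?a)\<^sup>2 = 1 / r ^ 4"
      by (simp add: a power_divide flip: power_mult)
    also have "reciprocal_poly Q \<circ>\<^sub>p [:0, ?a:]
        = smult (1 / of_real r ^ degree Q) (blaschke_cofactor r Q)"
      using elim by (intro scaled_cofactor_eq_dilation[symmetric]) auto
    finally show ?case .
  qed
  show ?thesis
    by (rule tendsto_sandwich[OF _ bound tendsto_const lim])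
      (simp add: dirichlet_norm_sq_nonneg)
qed

lemma exists_contracting_radius:
  assumes "degree Q > 0"
  shows "\<exists>r>0. dirichlet_norm_sq (smult (1 / of_real r ^ degree Q) (blaschke_cofactor r Q))
            \<le> 1 / 2 * dirichlet_norm_sq Q"
proof -
  have "\<forall>\<^sub>F r in at_top.
      dirichlet_norm_sq (smult (1 / of_real r ^ degree Q) (blaschke_cofactor r Q))
        < 1 / 2 * dirichlet_norm_sq Q"
    by (rule order_tendstoD(2)[OF dirichlet_norm_sq_scaled_cofactor_tendsto_0])
      (simp add: dirichlet_norm_sq_pos[OF assms])
  moreover have "\<forall>\<^sub>F r in at_top. r > (0::real)"
    by (rule eventually_gt_at_top)
  ultimately have "\<forall>\<^sub>F r in at_top. r > 0 \<and>
      dirichlet_norm_sq (smult (1 / of_real r ^ degree Q) (blaschke_cofactor r Q))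
        \<le> 1 / 2 * dirichlet_norm_sq Q"
    by eventually_elim auto
  thus ?thesis
    by (metis (no_types, lifting) eventually_happens trivial_limit_at_top_linorder)
qed

theorem theorem2p3:
  fixes F :: "complex poly" and n :: nat
  assumes "degree F = n" and "n \<ge> 1"
  shows "\<exists>(r :: nat \<Rightarrow> real) (P :: nat \<Rightarrow> complex poly).
           (\<forall>i\<in>{1..n}. r i > 0) \<and>
           iterated_blaschke F n r P \<and>
           (\<forall>i\<in>{1..n}. degree (P (i - 1)) > 0 \<longrightarrow>
              dirichlet_norm_sq
                (smult (1 / of_real (r i) ^ degree (minus_const (P (i - 1)))) (P i))
              \<le> 1 / 2 * dirichlet_norm_sq (minus_const (P (i - 1))))"
proof -
  \<comment> \<open>A radius for every polynomial, positive also for constant ones, where the iteration has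
    stopped and the radius is arbitrary.\<close>
  have "\<forall>Q. \<exists>r>0. degree Q > 0 \<longrightarrow>
      dirichlet_norm_sq (smult (1 / of_real r ^ degree Q) (blaschke_cofactor r Q))
        \<le> 1 / 2 * dirichlet_norm_sq Q"
    using exists_contracting_radius zero_less_one by metis
  then obtain \<rho> where \<rho>_pos: "\<And>Q. \<rho> Q > 0"
    and \<rho>: "\<And>Q. degree Q > 0 \<Longrightarrow>
      dirichlet_norm_sq (smult (1 / of_real (\<rho> Q) ^ degree Q) (blaschke_cofactor (\<rho> Q) Q))
        \<le> 1 / 2 * dirichlet_norm_sq Q"
    by metis
  define P where "P = rec_nat F (\<lambda>_ p. if degree p = 0 then 0
    else blaschke_cofactor (\<rho> (minus_const p)) (minus_const p))"
  define r where "r i = \<rho> (minus_const (P (i - 1)))" for i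
  have P_step: "P i = (if degree (P (i - 1)) = 0 then 0
      else blaschke_cofactor (r i) (minus_const (P (i - 1))))" if "i \<in> {1..n}" for i
    using that by (cases i) (auto simp: P_def r_def)
  show ?thesis
  proof (intro exI conjI ballI impI)
    show "r i > 0" for i
      by (simp add: r_def \<rho>_pos)
    show "iterated_blaschke F n r P"
      unfolding iterated_blaschke_def
      using P_step blaschke_factorization_cofactor \<rho>_pos
      by (auto simp: P_def r_def)
    show "dirichlet_norm_sq (smult (1 / of_real (r i) ^ degree (minus_const (P (i - 1)))) (P i))
        \<le> 1 / 2 * dirichlet_norm_sq (minus_const (P (i - 1)))"
      if "i \<in> {1..n}" "degree (P (i - 1)) > 0" for i
      using \<rho>[of "minus_const (P (i - 1))"] P_step[of i] that
      by (simp add: degree_minus_const r_def)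
  qed
qed

end
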